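(* (a) Let $q<0$ be real. The real solutions of $x^3+x+q=0$ are exactly the $x$-coordinates of the intersection points, other than the origin, of the parabola $y=x^2$ with the circle $\left(x+\frac q2\right)^2+y^2=\frac{q^2}{4}$ in $\mathbb{R}^2$. (b) Let $q'>0$ be real. The real solutions of $x^3-x+q'=0$ are exactly the $x$-coordinates of the intersection points, other than the origin, of the parabola $y=x^2$ with the hyperbola $\left(x-\frac{q'}2\right)^2-y^2=\frac{q'^2}{4}$ in $\mathbb{R}^2$. *)

theory Defs
  imports Complex_Main
begin

end

theory Submission
  imports Defs
begin

text \<open>Circle and hyperbola are the cases \<open>s = 1\<close> and \<open>s = -1\<close> (the latter with \<open>q = -q'\<close>) of the
  conic \<open>(x + q / 2)\<^sup>2 + s y\<^sup>2 = q\<^sup>2 / 4\<close>, which passes through the origin. Substituting \<open>y = x\<^sup>2\<close>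
  therefore leaves \<open>x\<close> times the cubic \<open>s x\<^sup>3 + x + q\<close>, and for \<open>q \<noteq> 0\<close> the factor \<open>x\<close> accounts
  for the origin and nothing else.\<close>

lemma fst_image_graph_Int:
  "fst ` ({(x, y). y = f x} \<inter> C) = {x. (x, f x) \<in> C}"
  by force

lemma conic_on_parabola_factorization:
  fixes q s x :: "'a::field"
  assumes "(2::'a) \<noteq> 0"
  shows "(x + q / 2)\<^sup>2 + s * (x\<^sup>2)\<^sup>2 - q\<^sup>2 / 4 = x * (s * x ^ 3 + x + q)"
proof -
  have "(2::'a)\<^sup>2 = 4"
    by simp
  then have "(x + q / 2)\<^sup>2 - q\<^sup>2 / 4 = x\<^sup>2 + x * q"
    using assms by (simp add: power2_sum power_divide)
  then show ?thesis
    by (simp add: algebra_simps power2_eq_square power3_eq_cube)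
qed

theorem cubic_roots_eq_fst_image_parabola_Int_conic:
  fixes q s :: "'a::field"
  assumes "(2::'a) \<noteq> 0" and "q \<noteq> 0"
  shows "{x. s * x ^ 3 + x + q = 0} =
    fst ` ({(x, y). y = x\<^sup>2} \<inter> {(x, y). (x + q / 2)\<^sup>2 + s * y\<^sup>2 = q\<^sup>2 / 4} - {(0, 0)})"
proof -
  have on_parabola_iff:
    "(x + q / 2)\<^sup>2 + s * (x\<^sup>2)\<^sup>2 = q\<^sup>2 / 4 \<longleftrightarrow> x = 0 \<or> s * x ^ 3 + x + q = 0" for x
    using conic_on_parabola_factorization[OF assms(1), of x q s]
    by (metis eq_iff_diff_eq_0 mult_eq_0_iff)
  show ?thesis
    unfolding Int_Diff fst_image_graph_Int Diff_iff mem_Collect_eq prod.case on_parabola_iff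
    using \<open>q \<noteq> 0\<close> by auto
qed

theorem mainTheorem9:
  shows "(\<forall>q::real. q < 0 \<longrightarrow>
           {x::real. x ^ 3 + x + q = 0} =
           fst ` ({(x::real, y::real). y = x\<^sup>2}
                  \<inter> {(x, y). (x + q / 2)\<^sup>2 + y\<^sup>2 = q\<^sup>2 / 4} - {(0, 0)})) \<and>
         (\<forall>q'::real. q' > 0 \<longrightarrow>
           {x::real. x ^ 3 - x + q' = 0} =
           fst ` ({(x::real, y::real). y = x\<^sup>2}
                  \<inter> {(x, y). (x - q' / 2)\<^sup>2 - y\<^sup>2 = q'\<^sup>2 / 4} - {(0, 0)}))"
proof (intro conjI allI impI)
  fix q :: real
  assume "q < 0"
  then show "{x. x ^ 3 + x + q = 0} =
    fst ` ({(x, y). y = x\<^sup>2} \<inter> {(x, y). (x + q / 2)\<^sup>2 + y\<^sup>2 = q\<^sup>2 / 4} - {(0, 0)})"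
    using cubic_roots_eq_fst_image_parabola_Int_conic[of q 1] by simp
next
  fix q' :: real
  assume "q' > 0"
  have "{x. x ^ 3 - x + q' = 0} = {x. - 1 * x ^ 3 + x + - q' = 0}"
    by auto
  also have "\<dots> =
    fst ` ({(x, y). y = x\<^sup>2} \<inter> {(x, y). (x - q' / 2)\<^sup>2 - y\<^sup>2 = q'\<^sup>2 / 4} - {(0, 0)})"
    using \<open>q' > 0\<close> cubic_roots_eq_fst_image_parabola_Int_conic[of "- q'" "- 1"] by simp
  finally show "{x. x ^ 3 - x + q' = 0} =
    fst ` ({(x, y). y = x\<^sup>2} \<inter> {(x, y). (x - q' / 2)\<^sup>2 - y\<^sup>2 = q'\<^sup>2 / 4} - {(0, 0)})" .
qed

end
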